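(* Let $k\ge1$ be an integer and let $a>3/4$ be a real number such that none of $a,a+1,\dots,a+k-1$ is a perfect square. Then $$\sum_{n=0}^{\infty}(-1)^n\frac{\Gamma(a-n^2)}{\Gamma(a+k-n^2)}=\sum_{n=0}^{\infty}\frac{(-1)^n}{\prod_{j=0}^{k-1}(a+j-n^2)}=\frac12\frac{\Gamma(a)}{\Gamma(a+k)}+\frac{\pi}{2(k-1)!}\sum_{n=0}^{k-1}(-1)^n\binom{k-1}{n}\frac{\csc\!\left(\pi\sqrt{a+n}\right)}{\sqrt{a+n}}.$$
   Context: The ratio $\Gamma(a-n^2)/\Gamma(a+k-n^2)$ is understood as $1/\prod_{j=0}^{k-1}(a+j-n^2)$ (its limiting value if $a$ is an integer). *)

theory Defs
  imports "HOL-Analysis.Analysis"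
begin

definition csc :: "real \<Rightarrow> real" where
  "csc x = 1 / sin x"

text \<open>
  The quotient \<open>\<Gamma>(x) / \<Gamma>(x + k)\<close>, given its limiting value where \<open>x\<close> is a pole of \<open>\<Gamma>\<close>.
  The case distinction is needed because the library sets \<open>Gamma x = 0\<close> at the poles, so the
  plain quotient would be \<open>0\<close> there. At a pole \<open>x\<close>, the limit exists whenever none of
  \<open>x, x + 1, \<dots>, x + k - 1\<close> is zero.
\<close>

definition Gamma_ratio :: "real \<Rightarrow> nat \<Rightarrow> real" where
  "Gamma_ratio x k =
     (if x \<in> \<int>\<^sub>\<le>\<^sub>0 then Lim (at x) (\<lambda>t. Gamma t / Gamma (t + real k))
      else Gamma x / Gamma (x + real k))"

end

theory Submission
  imports Defs "HOL-Real_Asymp.Real_Asymp"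
begin

text \<open>
  Writing the quotient of Gamma values as \<open>1 / pochhammer (a - n\<^sup>2) k\<close> makes the summand a rational
  function of \<open>n\<^sup>2\<close> with simple poles, and its partial fraction expansion
  (\<open>partial_fractions_pochhammer\<close>) is a combination of the terms \<open>1 / (a + j - n\<^sup>2)\<close> with
  coefficients \<open>(-1) ^ j * (k - 1 choose j) / (k - 1)!\<close> that do not depend on \<open>n\<close>. The series thus
  splits into finitely many series of the form \<open>\<Sum>n. (-1) ^ n / (b - n\<^sup>2)\<close>, and each of these is the
  classical expansion of the cosecant at \<open>pi * sqrt b\<close> (\<open>csc_alternating_sums\<close>). The value at \<open>b\<close>
  contains an extra \<open>1 / (2 * b)\<close>, because the sum starts at \<open>n = 0\<close> instead of running over all
  integers; recombining these extra terms by the same partial fraction expansion, now at \<open>a\<close>,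
  gives the summand \<open>Gamma a / Gamma (a + k) / 2\<close>.

  The cosecant expansion comes from the Gamma function. The logarithmic derivative of the reflection
  formula expresses \<open>pi * cot (pi * x)\<close> as \<open>Digamma (1 - x) - Digamma x\<close>, whose limit representation
  is the partial fraction series of the cotangent. The identity \<open>csc x = cot (x / 2) - cot x\<close>
  then puts the alternating signs in: the series for \<open>x / 2\<close> counts the poles at the even integers
  twice, and subtracting the series for \<open>x\<close> leaves them with weight \<open>1\<close> and the odd ones with
  weight \<open>-1\<close>.
\<close>

section \<open>Partial fractions\<close>

text \<open>
  The induction step uses the telescoping identity
  \<open>(k + 1) / pochhammer x (k + 2) = 1 / pochhammer x (k + 1) - 1 / pochhammer (x + 1) (k + 1)\<close>,
  which on the side of the sum is Pascal's rule.
\<close>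

lemma partial_fractions_pochhammer:
  fixes x :: "'a :: field_char_0"
  assumes "\<And>j. j \<le> k \<Longrightarrow> x + of_nat j \<noteq> 0"
  shows "(\<Sum>j\<le>k. (-1) ^ j * of_nat (k choose j) / (x + of_nat j)) = fact k / pochhammer x (Suc k)"
  using assms
proof (induction k arbitrary: x)
  case 0
  then show ?case by simp
next
  case (Suc k)
  define f where "f = (\<lambda>k x. \<Sum>j\<le>k. (-1) ^ j * of_nat (k choose j) / (x + of_nat j :: 'a))"
  have IH1: "f k x = fact k / pochhammer x (Suc k)"
    unfolding f_def by (rule Suc.IH) (use Suc.prems in auto)
  have IH2: "f k (x + 1) = fact k / pochhammer (x + 1) (Suc k)"
    unfolding f_def
  proof (rule Suc.IH)
    show "x + 1 + of_nat j \<noteq> 0" if "j \<le> k" for j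
      using Suc.prems[of "Suc j"] that by (simp add: add_ac)
  qed
  have "f (Suc k) x = 1 / x + (\<Sum>j\<le>k. (-1) ^ Suc j * of_nat (Suc k choose Suc j) / (x + of_nat (Suc j)))"
    unfolding f_def by (subst sum.atMost_Suc_shift) simp
  also have "(\<Sum>j\<le>k. (-1) ^ Suc j * of_nat (Suc k choose Suc j) / (x + of_nat (Suc j))) =
      (\<Sum>j\<le>k. (-1) ^ Suc j * of_nat (k choose Suc j) / (x + of_nat (Suc j))) - f k (x + 1)"
    unfolding f_def sum_subtractf [symmetric]
    by (intro sum.cong) (simp_all add: add_ac add_divide_distrib diff_divide_distrib ring_distribs)
  also have "1 / x + \<dots> = (\<Sum>j\<le>Suc k. (-1) ^ j * of_nat (k choose j) / (x + of_nat j)) - f k (x + 1)"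
    by (subst sum.atMost_Suc_shift) simp
  also have "\<dots> = f k x - f k (x + 1)"
    by (simp add: f_def)
  also have "\<dots> = fact (Suc k) / pochhammer x (Suc (Suc k))"
  proof -
    have nz: "x \<noteq> 0" "x + of_nat (Suc k) \<noteq> 0" "pochhammer (x + 1) k \<noteq> 0"
      using Suc.prems[of 0] Suc.prems[of "Suc k"] Suc.prems[of "Suc j" for j]
      by (auto simp: pochhammer_prod add_ac)
    have "pochhammer x (Suc k) = x * pochhammer (x + 1) k"
      by (rule pochhammer_rec)
    moreover have last: "pochhammer (x + 1) (Suc k) = pochhammer (x + 1) k * (x + of_nat (Suc k))"
      by (simp only: pochhammer_Suc) (simp add: add_ac)
    moreover have "pochhammer x (Suc (Suc k)) = x * (pochhammer (x + 1) k * (x + of_nat (Suc k)))"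
      by (simp only: pochhammer_rec[of x "Suc k"] last)
    moreover have "fact (Suc k) = (of_nat (Suc k) * fact k :: 'a)" by simp
    ultimately show ?thesis
      using nz unfolding IH1 IH2 by (simp only: mult_eq_0_iff) (simp add: divide_simps; simp add: algebra_simps)
  qed
  finally show ?case by (simp add: f_def)
qed

section \<open>The expansion of the cosecant\<close>

text \<open>
  Both sides of \<open>Gamma t * Gamma (1 - t) = pi / sin (pi * t)\<close> are differentiated. With the values
  that \<open>Gamma\<close> and division take at poles, the formula holds for all real \<open>t\<close>, so the two
  derivatives can be compared without restricting to a neighbourhood.
\<close>

lemma Digamma_reflection_real:
  fixes x :: real
  assumes "x \<notin> \<int>"
  shows "Digamma (1 - x) - Digamma x = pi * cot (pi * x)"
proof -
  have reflection: "Gamma t * Gamma (1 - t) = pi / sin (pi * t)" for t :: real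
  proof -
    have "complex_of_real (Gamma t * Gamma (1 - t)) = of_real (pi / sin (pi * t))"
      using Gamma_reflection_complex[of "of_real t"]
        Gamma_complex_of_real[of t] Gamma_complex_of_real[of "1 - t"]
      by (simp add: sin_of_real [symmetric])
    thus ?thesis by (simp only: of_real_eq_iff)
  qed
  have nz: "x \<notin> \<int>\<^sub>\<le>\<^sub>0" "1 - x \<notin> \<int>\<^sub>\<le>\<^sub>0"
    using assms nonpos_Ints_subset_Ints Ints_diff[of 1 "1 - x"] by auto
  have sin: "sin (pi * x) \<noteq> 0"
    using assms by (auto simp: sin_zero_iff_int2)
  have "((\<lambda>t. Gamma t * Gamma (1 - t)) has_real_derivative
      Gamma x * Gamma (1 - x) * (Digamma x - Digamma (1 - x))) (at x)"
    using nz by (auto intro!: derivative_eq_intros simp: algebra_simps)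
  moreover have "((\<lambda>t. pi / sin (pi * t)) has_real_derivative
      (pi / sin (pi * x)) * - (pi * cot (pi * x))) (at x)"
    using sin by (auto intro!: derivative_eq_intros simp: cot_def field_simps)
  ultimately have eq: "(pi / sin (pi * x)) * (Digamma x - Digamma (1 - x)) =
      (pi / sin (pi * x)) * - (pi * cot (pi * x))"
    unfolding reflection by (rule DERIV_unique)
  have "pi / sin (pi * x) \<noteq> 0" using sin by simp
  from eq[unfolded mult_left_cancel[OF this]]
  show ?thesis by simp
qed

text \<open>
  The logarithms in the limit representations of the two Digamma values cancel. The \<open>m\<close>-th partial sum
  runs over the poles at the integers from \<open>-(m - 1)\<close> to \<open>m\<close>.
\<close>

lemma cot_partial_fractions_LIMSEQ:
  fixes x :: real
  assumes "x \<notin> \<int>"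
  shows "(\<lambda>m. \<Sum>n<m. 1 / (x + real n) + 1 / (x - 1 - real n)) \<longlonglongrightarrow> pi * cot (pi * x)"
proof -
  have "x \<noteq> 0" "1 - x \<noteq> 0" using assms by auto
  from tendsto_diff[OF Digamma_LIMSEQ[OF this(2)] Digamma_LIMSEQ[OF this(1)]]
  have "(\<lambda>m. (\<Sum>n<m. inverse (x + real n)) - (\<Sum>n<m. inverse (1 - x + real n)))
      \<longlonglongrightarrow> pi * cot (pi * x)"
    using Digamma_reflection_real[OF assms] by simp
  also have "(\<lambda>m. (\<Sum>n<m. inverse (x + real n)) - (\<Sum>n<m. inverse (1 - x + real n))) =
      (\<lambda>m. \<Sum>n<m. 1 / (x + real n) + 1 / (x - 1 - real n))"
  proof -
    have "inverse (1 - x + real n) = - (1 / (x - 1 - real n))" for n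
    proof -
      have "1 - x + real n = - (x - 1 - real n)" by simp
      thus ?thesis by (simp only: inverse_minus_eq flip: inverse_eq_divide)
    qed
    thus ?thesis by (simp add: inverse_eq_divide sum.distrib sum_negf)
  qed
  finally show ?thesis .
qed

lemma cot_half_minus_cot:
  fixes x :: real
  assumes "sin x \<noteq> 0"
  shows "cot (x / 2) - cot x = csc x"
proof -
  define y where "y = x / 2"
  have x: "x = 2 * y" by (simp add: y_def)
  have "sin y \<noteq> 0" "cos y \<noteq> 0" using assms by (auto simp: x sin_double)
  hence "cot y - cot (2 * y) = csc (2 * y)"
    unfolding cot_def csc_def sin_double cos_double_cos by (simp add: divide_simps power2_eq_square)
  thus ?thesis by (simp add: x)
qed

text \<open>
  Taking \<open>m\<close> terms of the cotangent series at \<open>x / 2\<close> but \<open>2 * m\<close> terms at \<open>x\<close> covers the same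
  range of integers in both cases, from \<open>-(2 * m - 1)\<close> to \<open>2 * m\<close> (the former sum meets only the even
  ones), so the difference of the partial sums is exactly a partial sum of the alternating series.
\<close>

lemma csc_partial_fractions_LIMSEQ:
  fixes x :: real
  assumes "x \<notin> \<int>"
  shows "(\<lambda>m. \<Sum>n<2*m. (-1) ^ n * (1 / (x + real n) - 1 / (x - 1 - real n))) \<longlonglongrightarrow> pi * csc (pi * x)"
proof -
  define c where "c = (\<lambda>x m. \<Sum>n<m. 1 / (x + real n) + 1 / (x - 1 - real n))"
  have half: "x / 2 \<notin> \<int>"
  proof
    assume "x / 2 \<in> \<int>"
    hence "2 * (x / 2) \<in> \<int>" by (rule Ints_mult[OF Ints_numeral])
    with assms show False by simp
  qed
  have "(\<lambda>m. c (x / 2) m - c x (2 * m)) \<longlonglongrightarrow> pi * cot (pi * (x / 2)) - pi * cot (pi * x)"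
    unfolding c_def
    by (intro tendsto_diff cot_partial_fractions_LIMSEQ half
          filterlim_compose[OF cot_partial_fractions_LIMSEQ[OF assms]] mult_nat_left_at_top) simp
  also have "pi * cot (pi * (x / 2)) - pi * cot (pi * x) = pi * csc (pi * x)"
  proof -
    have "sin (pi * x) \<noteq> 0"
      using assms by (auto simp: sin_zero_iff_int2)
    from cot_half_minus_cot[OF this] show ?thesis
      by (simp flip: right_diff_distrib)
  qed
  also have "(\<lambda>m. c (x / 2) m - c x (2 * m)) =
      (\<lambda>m. \<Sum>n<2*m. (-1) ^ n * (1 / (x + real n) - 1 / (x - 1 - real n)))"
  proof
    show "c (x / 2) m - c x (2 * m) =
        (\<Sum>n<2*m. (-1) ^ n * (1 / (x + real n) - 1 / (x - 1 - real n)))" for m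
    proof (induction m)
      case 0
      show ?case by (simp add: c_def)
    next
      case (Suc m)
      let ?d = "\<lambda>n. (-1) ^ n * (1 / (x + real n) - 1 / (x - 1 - real n))"
      have split: "sum f {..<2 * Suc m} = sum f {..<2 * m} + f (2 * m) + f (Suc (2 * m))"
        for f :: "nat \<Rightarrow> real" by simp
      have "x / 2 + real m = (x + real (2 * m)) / 2"
        "x / 2 - 1 - real m = (x - 1 - real (Suc (2 * m))) / 2"
        by (simp_all add: field_simps)
      hence "c (x / 2) (Suc m) =
          c (x / 2) m + (2 / (x + real (2 * m)) + 2 / (x - 1 - real (Suc (2 * m))))"
        unfolding c_def by (simp only: sum.lessThan_Suc) simp
      moreover have "c x (2 * Suc m) = c x (2 * m) +
          (1 / (x + real (2 * m)) + 1 / (x - 1 - real (2 * m))) +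
          (1 / (x + real (Suc (2 * m))) + 1 / (x - 1 - real (Suc (2 * m))))"
        unfolding c_def split ..
      moreover have "?d (2 * m) = 1 / (x + real (2 * m)) - 1 / (x - 1 - real (2 * m))"
        "?d (Suc (2 * m)) = 1 / (x - 1 - real (Suc (2 * m))) - 1 / (x + real (Suc (2 * m)))"
        by simp_all
      ultimately show ?case
        unfolding split using Suc.IH by linarith
    qed
  qed
  finally show ?thesis .
qed

text \<open>
  The terms are of order \<open>1 / n\<^sup>2\<close>, so the series converges and its value can be read off the partial
  sums of even length. By \<open>2 * x / (x\<^sup>2 - n\<^sup>2) = 1 / (x + n) + 1 / (x - n)\<close> with \<open>x = sqrt b\<close>, these agree
  with the partial sums of the cosecant expansion up to an index shift in the terms \<open>1 / (x - n)\<close>;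
  the shift costs the boundary terms \<open>1 / x\<close> (the pole at \<open>0\<close> is counted twice) and
  \<open>1 / (x - 2 * m)\<close>, which vanishes in the limit.
\<close>

lemma csc_alternating_sums:
  fixes b :: real
  assumes "b > 0" and nonsquare: "\<And>m::nat. b \<noteq> (real m)\<^sup>2"
  shows "(\<lambda>n. (-1) ^ n / (b - (real n)\<^sup>2)) sums
           (1 / (2 * b) + pi / 2 * (csc (pi * sqrt b) / sqrt b))"
proof -
  define x where "x = sqrt b"
  have x: "x > 0" "b = x\<^sup>2" using assms(1) by (auto simp: x_def)
  have neq: "x \<noteq> real n" for n using nonsquare[of n] x by auto
  have "x \<notin> \<int>"
  proof
    assume "x \<in> \<int>"
    with x(1) obtain n where "x = real n"
      by (metis Ints_cases of_int_0_less_iff zero_less_imp_eq_int of_int_of_nat_eq)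
    with neq show False by blast
  qed
  let ?f = "\<lambda>n. (-1) ^ n / (b - (real n)\<^sup>2)"
  have "summable ?f"
  proof (rule summable_comparison_test_bigo)
    show "summable (\<lambda>n. norm (1 / (real n) ^ 2))"
      using inverse_power_summable[of 2, where ?'a = real] by (simp add: inverse_eq_divide)
    have "(\<lambda>n. 1 / (b - (real n)\<^sup>2)) \<in> O(\<lambda>n. 1 / (real n) ^ 2)"
      by real_asymp
    thus "?f \<in> O(\<lambda>n. 1 / (real n) ^ 2)"
      by (simp add: bigo_def norm_divide norm_power)
  qed
  hence "(\<lambda>m. sum ?f {..<2*m}) \<longlonglongrightarrow> suminf ?f"
    by (intro filterlim_compose[OF summable_LIMSEQ] mult_nat_left_at_top) simp_all
  moreover have "(\<lambda>m. sum ?f {..<2*m}) \<longlonglongrightarrow> (pi * csc (pi * x) + 1 / x - 0) / (2 * x)"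
  proof -
    let ?g = "\<lambda>n. (-1) ^ n / (x - real n)"
    have shift: "(\<Sum>n<N. ?g (Suc n)) = sum ?g {..<N} - 1 / x + ?g N" for N
      by (induction N) simp_all
    have "2 * x * ?f n = (-1) ^ n / (x + real n) + ?g n" for n
    proof -
      have "x + real n \<noteq> 0" "x - real n \<noteq> 0" using x(1) neq[of n] by auto
      moreover have "b - (real n)\<^sup>2 = (x + real n) * (x - real n)"
        by (simp add: x(2) power2_eq_square algebra_simps)
      ultimately show ?thesis by (simp add: field_simps)
    qed
    hence "2 * x * sum ?f {..<N} = (\<Sum>n<N. (-1) ^ n / (x + real n)) + sum ?g {..<N}" for N
      by (simp add: sum_distrib_left sum.distrib)
    also have "\<dots> N = (\<Sum>n<N. (-1) ^ n * (1 / (x + real n) - 1 / (x - 1 - real n))) + 1 / x - ?g N" for N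
    proof -
      have "(\<Sum>n<N. (-1) ^ n * (1 / (x + real n) - 1 / (x - 1 - real n))) =
          (\<Sum>n<N. (-1) ^ n / (x + real n)) + (\<Sum>n<N. ?g (Suc n))"
        by (simp add: sum.distrib [symmetric] right_diff_distrib diff_diff_eq)
      thus ?thesis unfolding shift by simp
    qed
    finally have eq: "sum ?f {..<N} =
        ((\<Sum>n<N. (-1) ^ n * (1 / (x + real n) - 1 / (x - 1 - real n))) + 1 / x - ?g N) / (2 * x)" for N
      using x(1) by (simp add: field_simps)
    have "(\<lambda>m. 1 / (x - real (2 * m))) \<longlonglongrightarrow> 0" by real_asymp
    hence "(\<lambda>m. ?g (2 * m)) \<longlonglongrightarrow> 0" by simp
    thus ?thesis
      unfolding eq using x(1)
      by (intro tendsto_intros csc_partial_fractions_LIMSEQ \<open>x \<notin> \<int>\<close>) auto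
  qed
  ultimately have "suminf ?f = (pi * csc (pi * x) + 1 / x - 0) / (2 * x)"
    by (rule LIMSEQ_unique)
  also have "\<dots> = 1 / (2 * b) + pi / 2 * (csc (pi * sqrt b) / sqrt b)"
    using x(1) unfolding x_def [symmetric] x(2) by (simp add: field_simps power2_eq_square)
  finally show ?thesis using summable_sums[OF \<open>summable ?f\<close>] by simp
qed

section \<open>The quotient of Gamma values\<close>

text \<open>
  Away from the poles this is the functional equation of \<open>Gamma\<close>. At a pole \<open>x\<close> the functional
  equation holds in a punctured neighbourhood, since the poles are isolated, and the right-hand side
  is continuous at \<open>x\<close>.
\<close>

lemma Gamma_ratio_eq_pochhammer:
  assumes "pochhammer x k \<noteq> 0"
  shows "Gamma_ratio x k = 1 / pochhammer x k"
proof -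
  have quot: "Gamma t / Gamma (t + real k) = 1 / pochhammer t k" if "t \<notin> \<int>\<^sub>\<le>\<^sub>0" for t :: real
    using that by (simp add: pochhammer_Gamma)
  have "Lim (at x) (\<lambda>t. Gamma t / Gamma (t + real k)) = 1 / pochhammer x k"
  proof (rule tendsto_Lim)
    have "closed (\<int>\<^sub>\<le>\<^sub>0 - {x})" by (rule closed_subset_Ints) (auto simp: nonpos_Ints_def)
    hence "eventually (\<lambda>t. t \<in> - (\<int>\<^sub>\<le>\<^sub>0 - {x})) (nhds x)"
      by (intro eventually_nhds_in_open open_Compl) auto
    hence "eventually (\<lambda>t. 1 / pochhammer t k = Gamma t / Gamma (t + real k)) (at x)"
      unfolding eventually_at_filter by eventually_elim (use quot in auto)
    moreover have "((\<lambda>t. 1 / pochhammer t k) \<longlongrightarrow> 1 / pochhammer x k) (at x)"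
      using assms unfolding pochhammer_prod by (intro tendsto_intros)
    ultimately show "((\<lambda>t. Gamma t / Gamma (t + real k)) \<longlongrightarrow> 1 / pochhammer x k) (at x)"
      by (rule Lim_transform_eventually [rotated])
  qed simp
  with quot show ?thesis by (simp add: Gamma_ratio_def)
qed

section \<open>Evaluation of the series\<close>

theorem mainTheorem12:
  fixes k :: nat and a :: real
  assumes "k \<ge> 1"
    and "a > 3 / 4"
    and "\<And>j. j < k \<Longrightarrow> \<not> (\<exists>m::nat. a + real j = (real m)\<^sup>2)"
  defines "S \<equiv> 1 / 2 * (Gamma a / Gamma (a + real k)) +
     pi / (2 * fact (k - 1)) *
       (\<Sum>n = 0..k - 1. (-1) ^ n * real ((k - 1) choose n) *
          (csc (pi * sqrt (a + real n)) / sqrt (a + real n)))"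
  shows "(\<lambda>n::nat. (-1) ^ n * Gamma_ratio (a - (real n)\<^sup>2) k) sums S \<and>
         (\<lambda>n::nat. (-1) ^ n / (\<Prod>j = 0..k - 1. a + real j - (real n)\<^sup>2)) sums S"
proof -
  define l where "l = k - 1"
  have k: "k = Suc l" using assms(1) by (simp add: l_def)
  let ?c = "\<lambda>j. (-1) ^ j * real (l choose j)"
  have nz: "a - (real n)\<^sup>2 + real j \<noteq> 0" if "j \<le> l" for n j
    using assms(3)[of j] that by (auto simp: k algebra_simps)
  have poch_nz: "pochhammer (a - (real n)\<^sup>2) k \<noteq> 0" for n
    using nz[of _ n] by (fastforce simp: pochhammer_eq_0_iff k less_Suc_eq_le)
  have "(\<lambda>n. (\<Sum>j\<le>l. ?c j * ((-1) ^ n / (a + real j - (real n)\<^sup>2))) / fact l) sums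
      ((\<Sum>j\<le>l. ?c j * (1 / (2 * (a + real j)) +
         pi / 2 * (csc (pi * sqrt (a + real j)) / sqrt (a + real j)))) / fact l)"
    using assms(2,3) by (intro sums_divide sums_sum sums_mult csc_alternating_sums) (auto simp: k)
  also have "(\<lambda>n. (\<Sum>j\<le>l. ?c j * ((-1) ^ n / (a + real j - (real n)\<^sup>2))) / fact l) =
      (\<lambda>n. (-1) ^ n / pochhammer (a - (real n)\<^sup>2) k)"
  proof
    fix n
    have "(\<Sum>j\<le>l. ?c j * ((-1) ^ n / (a + real j - (real n)\<^sup>2))) =
        (-1) ^ n * (\<Sum>j\<le>l. ?c j / (a - (real n)\<^sup>2 + real j))"
      by (simp add: sum_distrib_left algebra_simps)
    also have "(\<Sum>j\<le>l. ?c j / (a - (real n)\<^sup>2 + real j)) = fact l / pochhammer (a - (real n)\<^sup>2) k"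
      unfolding k by (rule partial_fractions_pochhammer) (rule nz)
    finally show "(\<Sum>j\<le>l. ?c j * ((-1) ^ n / (a + real j - (real n)\<^sup>2))) / fact l =
        (-1) ^ n / pochhammer (a - (real n)\<^sup>2) k" by simp
  qed
  also have "(\<Sum>j\<le>l. ?c j * (1 / (2 * (a + real j)) +
         pi / 2 * (csc (pi * sqrt (a + real j)) / sqrt (a + real j)))) / fact l = S"
  proof -
    have "(\<Sum>j\<le>l. ?c j / (a + real j)) = fact l / pochhammer a k"
      unfolding k by (rule partial_fractions_pochhammer) (use assms(2) in auto)
    moreover have "1 / pochhammer a k = Gamma a / Gamma (a + real k)"
      using assms(2) by (subst pochhammer_Gamma) (auto elim!: nonpos_Ints_cases)
    ultimately have "(\<Sum>j\<le>l. ?c j / (a + real j)) / fact l = Gamma a / Gamma (a + real k)"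
      by simp
    moreover have "(\<Sum>j\<le>l. ?c j * (1 / (2 * (a + real j)) +
         pi / 2 * (csc (pi * sqrt (a + real j)) / sqrt (a + real j)))) =
        1 / 2 * (\<Sum>j\<le>l. ?c j / (a + real j)) +
        pi / 2 * (\<Sum>j\<le>l. ?c j * (csc (pi * sqrt (a + real j)) / sqrt (a + real j)))"
      unfolding sum_distrib_left sum.distrib [symmetric] by (simp add: algebra_simps)
    ultimately show ?thesis
      unfolding S_def by (simp add: add_divide_distrib l_def atLeast0AtMost)
  qed
  finally have main: "(\<lambda>n. (-1) ^ n / pochhammer (a - (real n)\<^sup>2) k) sums S" .
  have "pochhammer (a - (real n)\<^sup>2) k = (\<Prod>j = 0..k - 1. a + real j - (real n)\<^sup>2)" for n
    unfolding pochhammer_prod k by (intro prod.cong) auto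
  with main Gamma_ratio_eq_pochhammer[OF poch_nz] show ?thesis by simp
qed

end
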